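(* Let $G$ be a connected cubic graph. The following are equivalent: (1) $G$ is localizable; (2) every vertex of $G$ is contained in a strong clique; (3) $G$ is isomorphic to one of the graphs in $\{K_{3,3},K_4,\overline{C_6}\}\cup\{F_n\mid n\ge 2\}$.
   Context: All graphs are finite, simple and undirected. A graph is cubic if every vertex has degree $3$. A clique is strong if it intersects every maximal independent set; a graph is localizable if its vertex set can be partitioned into strong cliques. $\overline{C_6}$ is the complement of the $6$-cycle. For $n\ge 2$, $F_n$ is the graph with vertex set $\{x_i,x'_i,y_i,y'_i,z_i,z'_i : 1\le i\le n\}$ whose edges are: for each $i$, the triangles $x_iy_iz_i$ and $x'_iy'_iz'_i$ and the edges $y_iy'_i$, $z_iz'_i$; and for each $i$, the edge $x_ix'_{i+1}$, indices taken modulo $n$ (so the last one is $x_nx'_1$). *)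

theory Defs
  imports "Graph_Theory.Graph_Theory" "HOL-Library.Disjoint_Sets"
begin

text \<open>
  Finite simple undirected graphs are the library's \<^locale>\<open>graph\<close>: finite symmetric digraphs
  without loops and parallel arcs. An undirected edge is a pair of opposite arcs, so the degree of
  a vertex is its \<^const>\<open>out_degree\<close>.
\<close>

definition cubic :: "('a, 'b) pre_digraph \<Rightarrow> bool" where
  "cubic G \<longleftrightarrow> (\<forall>v \<in> verts G. out_degree G v = 3)"

definition clique :: "('a, 'b) pre_digraph \<Rightarrow> 'a set \<Rightarrow> bool" where
  "clique G C \<longleftrightarrow> C \<subseteq> verts G \<and> (\<forall>u \<in> C. \<forall>v \<in> C. u \<noteq> v \<longrightarrow> u \<rightarrow>\<^bsub>G\<^esub> v)"

definition independent_set :: "('a, 'b) pre_digraph \<Rightarrow> 'a set \<Rightarrow> bool" where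
  "independent_set G S \<longleftrightarrow> S \<subseteq> verts G \<and> (\<forall>u \<in> S. \<forall>v \<in> S. \<not> u \<rightarrow>\<^bsub>G\<^esub> v)"

definition maximal_independent_set :: "('a, 'b) pre_digraph \<Rightarrow> 'a set \<Rightarrow> bool" where
  "maximal_independent_set G S \<longleftrightarrow>
     independent_set G S \<and> (\<forall>T. independent_set G T \<and> S \<subseteq> T \<longrightarrow> T = S)"

definition strong_clique :: "('a, 'b) pre_digraph \<Rightarrow> 'a set \<Rightarrow> bool" where
  "strong_clique G C \<longleftrightarrow> clique G C \<and> (\<forall>S. maximal_independent_set G S \<longrightarrow> C \<inter> S \<noteq> {})"

definition localizable :: "('a, 'b) pre_digraph \<Rightarrow> bool" where
  "localizable G \<longleftrightarrow> (\<exists>P. partition_on (verts G) P \<and> (\<forall>C \<in> P. strong_clique G C))"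

definition graph_complement :: "('a, 'b) pre_digraph \<Rightarrow> 'a pair_pre_digraph" where
  "graph_complement G = \<lparr> pverts = verts G,
     parcs = {(u, v). u \<in> verts G \<and> v \<in> verts G \<and> u \<noteq> v \<and> \<not> u \<rightarrow>\<^bsub>G\<^esub> v} \<rparr>"

text \<open>The \<open>n\<close>-cycle on \<open>{0..<n}\<close>; only meaningful for \<open>n \<ge> 3\<close>.\<close>

definition cycle_graph :: "nat \<Rightarrow> nat pair_pre_digraph" where
  "cycle_graph n = \<lparr> pverts = {0..<n}, parcs = symcl {(i, (i + 1) mod n) | i. i < n} \<rparr>"

datatype F_vertex = Fx nat | Fx' nat | Fy nat | Fy' nat | Fz nat | Fz' nat

text \<open>
  Indices range over \<open>{1..n}\<close>, hence the cyclic successor of \<open>i\<close> is \<open>i mod n + 1\<close>.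
  \<^const>\<open>symcl\<close> is the symmetric closure.
\<close>

definition F_graph :: "nat \<Rightarrow> F_vertex pair_pre_digraph" where
  "F_graph n = \<lparr>
     pverts = (\<Union>i \<in> {1..n}. {Fx i, Fx' i, Fy i, Fy' i, Fz i, Fz' i}),
     parcs = symcl (\<Union>i \<in> {1..n}.
       {(Fx i, Fy i), (Fy i, Fz i), (Fx i, Fz i),
        (Fx' i, Fy' i), (Fy' i, Fz' i), (Fx' i, Fz' i),
        (Fy i, Fy' i), (Fz i, Fz' i),
        (Fx i, Fx' (i mod n + 1))}) \<rparr>"

end

theory Submission
  imports Defs
begin

text \<open>
  A clique is strong iff no independent set dominates it. In a connected cubic graph this forces a
  strong clique to be the whole of \<open>K\<^sub>4\<close>, an edge of \<open>K\<^bsub>3,3\<^esub>\<close>, or a triangle whose three outer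
  neighbours are not independent. If every vertex lies in a strong triangle, diamonds are
  excluded, so the triangles partition the vertices and the remaining edges form a perfect matching
  \<open>mate\<close>. Strength of a triangle \<open>v a b\<close> means that two of the three mates, say those of \<open>a\<close> and
  \<open>b\<close>, lie in a common triangle, whose third vertex is \<open>far v\<close>. Following \<open>mate \<circ> far\<close> from one
  such \<open>v\<close> runs around a cycle of blocks, which is closed under adjacency and hence everything. This
  gives \<open>F\<^sub>n\<close>, where \<open>n = 1\<close> is allowed and \<open>F\<^sub>1\<close> is the complement of the 6-cycle.
\<close>

section \<open>Strong cliques in cubic graphs\<close>

text \<open>A maximal independent set \<open>S\<close> missing \<open>C\<close> must dominate every
  vertex of \<open>C\<close>, in particular \<open>p\<close> and \<open>q\<close>. Their neighbours
  in \<open>S\<close> lie outside \<open>C\<close>, so \<open>adj\<close> joins them, against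
  independence. If the two neighbours coincide, \<open>adj\<close> yields a loop, which independence
  excludes as well.\<close>

lemma strong_cliqueI:
  assumes "wf_digraph G" "clique G C" "p \<in> C" "q \<in> C"
    and adj: "\<And>p' q'. p \<rightarrow>\<^bsub>G\<^esub> p' \<Longrightarrow> q \<rightarrow>\<^bsub>G\<^esub> q' \<Longrightarrow> p' \<notin> C \<Longrightarrow> q' \<notin> C \<Longrightarrow> p' \<rightarrow>\<^bsub>G\<^esub> q'"
    and sym: "symmetric G" and irrefl: "\<And>v. \<not> v \<rightarrow>\<^bsub>G\<^esub> v"
  shows "strong_clique G C"
  unfolding strong_clique_def
proof (intro conjI allI impI notI)
  show "clique G C" by fact
next
  fix S assume S: "maximal_independent_set G S" and disj: "C \<inter> S = {}"
  have "\<exists>s\<in>S. c \<rightarrow>\<^bsub>G\<^esub> s" if "c \<in> C" for c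
  proof (rule ccontr)
    assume no: "\<not> (\<exists>s\<in>S. c \<rightarrow>\<^bsub>G\<^esub> s)"
    have "c \<in> verts G" using that assms(2) by (auto simp: clique_def)
    moreover have "independent_set G S" using S by (simp add: maximal_independent_set_def)
    ultimately have "independent_set G (insert c S)"
      using no irrefl by (auto simp: independent_set_def dest: arcs_ends_symmetric[OF sym])
    then have "insert c S = S" using S by (auto simp: maximal_independent_set_def)
    with that disj show False by auto
  qed
  then obtain s t where "s \<in> S" "t \<in> S" "p \<rightarrow>\<^bsub>G\<^esub> s" "q \<rightarrow>\<^bsub>G\<^esub> t"
    using assms(3,4) by blast
  with adj disj have "s \<rightarrow>\<^bsub>G\<^esub> t" by blast
  with \<open>s \<in> S\<close> \<open>t \<in> S\<close> S show False
    by (auto simp: maximal_independent_set_def independent_set_def)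
qed

lemma localizable_imp_strong_clique_at:
  "localizable G \<Longrightarrow> v \<in> verts G \<Longrightarrow> \<exists>C. strong_clique G C \<and> v \<in> C"
  unfolding localizable_def partition_on_def by blast

section \<open>Domination, degrees and connectedness in arbitrary graphs\<close>

context graph
begin

lemma adj_sym: "u \<rightarrow>\<^bsub>G\<^esub> v \<Longrightarrow> v \<rightarrow>\<^bsub>G\<^esub> u"
  using arcs_ends_symmetric[OF sym_arcs] .

lemma adj_irrefl: "\<not> v \<rightarrow>\<^bsub>G\<^esub> v"
  using adj_not_same by blast

text \<open>The classes are the fibres of a labelling \<open>l\<close>, which partition the vertices
  automatically. The pair \<open>p\<close>, \<open>q\<close> in each fibre is the certificate asked
  for by \<open>strong_cliqueI\<close>.\<close>

lemma localizableI:
  fixes l :: "'a \<Rightarrow> 'k"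
  assumes cl: "\<And>u v. u \<in> verts G \<Longrightarrow> v \<in> verts G \<Longrightarrow> l u = l v \<Longrightarrow> u \<noteq> v \<Longrightarrow> u \<rightarrow>\<^bsub>G\<^esub> v"
    and ex: "\<And>v. v \<in> verts G \<Longrightarrow> \<exists>p\<in>verts G. \<exists>q\<in>verts G. l p = l v \<and> l q = l v \<and>
      (\<forall>p' q'. p \<rightarrow>\<^bsub>G\<^esub> p' \<longrightarrow> q \<rightarrow>\<^bsub>G\<^esub> q' \<longrightarrow> l p' \<noteq> l v \<longrightarrow> l q' \<noteq> l v \<longrightarrow> p' \<rightarrow>\<^bsub>G\<^esub> q')"
  shows "localizable G"
proof -
  let ?C = "\<lambda>v. {u \<in> verts G. l u = l v}"
  have "strong_clique G (?C v)" if v: "v \<in> verts G" for v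
  proof -
    from ex[OF v] obtain p q where pq: "p \<in> ?C v" "q \<in> ?C v" and
      adj: "\<forall>p' q'. p \<rightarrow>\<^bsub>G\<^esub> p' \<longrightarrow> q \<rightarrow>\<^bsub>G\<^esub> q' \<longrightarrow> l p' \<noteq> l v \<longrightarrow> l q' \<noteq> l v \<longrightarrow> p' \<rightarrow>\<^bsub>G\<^esub> q'"
      by (elim bexE conjE) simp
    have "clique G (?C v)"
      unfolding clique_def by (intro conjI ballI impI cl) simp_all
    then show ?thesis
    proof (rule strong_cliqueI[OF wf_digraph _ pq(1,2)])
      fix p' q'
      assume "p \<rightarrow>\<^bsub>G\<^esub> p'" "q \<rightarrow>\<^bsub>G\<^esub> q'" "p' \<notin> ?C v" "q' \<notin> ?C v"
      then show "p' \<rightarrow>\<^bsub>G\<^esub> q'" using adj adj_in_verts by blast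
    qed (use sym_arcs adj_irrefl in blast)+
  qed
  moreover have "partition_on (verts G) (?C ` verts G)"
    by (auto simp: partition_on_def disjoint_def)
  ultimately show ?thesis unfolding localizable_def by blast
qed

text \<open>By finiteness \<open>S\<close> extends to a maximal independent set \<open>M\<close>. A
  common vertex of \<open>C\<close> and \<open>M\<close> would have a neighbour in \<open>S\<close>,
  hence in \<open>M\<close>.\<close>

lemma strong_clique_not_dominated:
  assumes C: "strong_clique G C" and S: "independent_set G S"
    and dom: "\<And>c. c \<in> C \<Longrightarrow> \<exists>s\<in>S. c \<rightarrow>\<^bsub>G\<^esub> s"
  shows False
proof -
  let ?I = "{T. independent_set G T \<and> S \<subseteq> T}"
  have "finite ?I"
    by (rule finite_subset[of _ "Pow (verts G)"]) (auto simp: independent_set_def)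
  moreover have "S \<in> ?I" using S by simp
  ultimately have "\<exists>M\<in>?I. S \<subseteq> M \<and> (\<forall>T\<in>?I. M \<subseteq> T \<longrightarrow> M = T)"
    by (rule finite_has_maximal2)
  then obtain M where M: "M \<in> ?I" "\<And>T. T \<in> ?I \<Longrightarrow> M \<subseteq> T \<Longrightarrow> M = T"
    by (elim bexE conjE) simp
  then have "maximal_independent_set G M"
    unfolding maximal_independent_set_def by blast
  with C obtain c where c: "c \<in> C" "c \<in> M" by (auto simp: strong_clique_def)
  from dom[OF c(1)] M(1) obtain s where "s \<in> M" "c \<rightarrow>\<^bsub>G\<^esub> s" by blast
  with c(2) M(1) show False by (auto simp: independent_set_def)
qed

lemma card_neighbours: "card {w. v \<rightarrow>\<^bsub>G\<^esub> w} = out_degree G v"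
proof -
  have "inj_on (head G) (out_arcs G v)"
    by (rule inj_onI) (auto intro: no_multi_arcs simp: arc_to_ends_def)
  moreover have "head G ` out_arcs G v = {w. v \<rightarrow>\<^bsub>G\<^esub> w}"
    by (auto simp: arcs_ends_conv)
  ultimately show ?thesis unfolding out_degree_def by (metis card_image)
qed

lemma finite_neighbours: "finite {w. v \<rightarrow>\<^bsub>G\<^esub> w}"
  by (rule finite_subset[OF _ finite_verts]) (use adj_in_verts in auto)

text \<open>Induction along a walk from \<open>a\<close> never leaves \<open>S\<close>. In this way
  a locally recognised subgraph is shown to be all of \<open>G\<close>.\<close>

lemma connected_closed_eq_verts:
  assumes conn: "connected G" and "a \<in> S" "S \<subseteq> verts G"
    and closed: "\<And>u v. u \<in> S \<Longrightarrow> u \<rightarrow>\<^bsub>G\<^esub> v \<Longrightarrow> v \<in> S"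
  shows "S = verts G"
proof -
  have "v \<in> S" if "a \<rightarrow>\<^sup>*\<^bsub>G\<^esub> v" for v
    using that by (induction rule: reachable_induct) (use assms in auto)
  moreover have "strongly_connected G"
    using conn by (rule symmetric_connected_imp_strongly_connected[OF sym_arcs])
  ultimately show ?thesis using assms by (auto simp: strongly_connected_def)
qed

end

section \<open>Possible sizes of strong cliques\<close>

locale connected_cubic_graph = graph G for G :: "('a, 'b) pre_digraph" (structure) +
  assumes conn: "connected G" and cubic: "cubic G"
begin

lemma card_neighbours_3: "v \<in> verts G \<Longrightarrow> card {w. v \<rightarrow>\<^bsub>G\<^esub> w} = 3"
  using cubic card_neighbours by (simp add: cubic_def)

lemma neighbours_eqI:
  assumes "v \<in> verts G" "A \<subseteq> {w. v \<rightarrow>\<^bsub>G\<^esub> w}" "card A = 3"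
  shows "{w. v \<rightarrow>\<^bsub>G\<^esub> w} = A"
  using card_subset_eq[OF finite_neighbours assms(2)] card_neighbours_3[OF assms(1)] assms(3) by simp

lemma clique_le_4:
  assumes "clique G C"
  shows "finite C" "card C \<le> 4"
proof -
  show fin: "finite C" using assms by (auto simp: clique_def intro: finite_subset)
  show "card C \<le> 4"
  proof (cases "C = {}")
    case False
    then obtain c where c: "c \<in> C" by blast
    then have "C - {c} \<subseteq> {w. c \<rightarrow>\<^bsub>G\<^esub> w}" using assms by (auto simp: clique_def)
    then have "card (C - {c}) \<le> card {w. c \<rightarrow>\<^bsub>G\<^esub> w}" by (rule card_mono[OF finite_neighbours])
    moreover have "c \<in> verts G" using c assms by (auto simp: clique_def)
    ultimately have "card (C - {c}) \<le> 3" using card_neighbours_3 by simp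
    then show ?thesis using c fin by simp
  qed simp
qed

text \<open>Each vertex of \<open>C\<close> spends its degree three inside \<open>C\<close>, so no
  edge leaves \<open>C\<close>.\<close>

lemma K4_if_clique_4:
  assumes C: "clique G C" and card: "card C = 4"
  shows "K\<^bsub>4\<^esub> G"
proof -
  have fin: "finite C" using card card.infinite by fastforce
  have nb: "{w. c \<rightarrow>\<^bsub>G\<^esub> w} = C - {c}" if "c \<in> C" for c
    by (rule neighbours_eqI) (use that C card fin in \<open>auto simp: clique_def\<close>)
  obtain a where "a \<in> C" using card by fastforce
  then have V: "C = verts G"
    by (rule connected_closed_eq_verts[OF conn]) (use C nb in \<open>auto simp: clique_def\<close>)
  have "arcs_ends G = {(u, v). (u, v) \<in> verts G \<times> verts G \<and> u \<noteq> v}"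
    using nb adj_in_verts unfolding V by auto
  then show ?thesis using card V graph_axioms by (simp add: complete_digraph_def)
qed

text \<open>Nonadjacent neighbours \<open>a\<close> of \<open>u\<close> and \<open>b\<close> of
  \<open>v\<close> would form an independent set dominating the edge. Hence the two neighbourhoods
  are completely joined; this includes \<open>a = b\<close>, so they are disjoint. With three
  vertices each, the join exhausts all degrees.\<close>

lemma K33_if_strong_edge:
  assumes C: "strong_clique G {u, v}" and "u \<noteq> v"
  shows "K\<^bsub>3,3\<^esub> G"
proof -
  have uv: "u \<rightarrow>\<^bsub>G\<^esub> v" "u \<in> verts G" "v \<in> verts G"
    using assms by (auto simp: strong_clique_def clique_def)
  define A where "A = {w. u \<rightarrow>\<^bsub>G\<^esub> w}"
  define B where "B = {w. v \<rightarrow>\<^bsub>G\<^esub> w}"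
  have AB: "a \<rightarrow>\<^bsub>G\<^esub> b" if ab: "a \<in> A" "b \<in> B" for a b
  proof (rule ccontr)
    assume "\<not> a \<rightarrow>\<^bsub>G\<^esub> b"
    then have "independent_set G {a, b}"
      using ab adj_in_verts adj_sym adj_irrefl by (auto simp: independent_set_def A_def B_def)
    then show False
      by (rule strong_clique_not_dominated[OF C]) (use ab in \<open>auto simp: A_def B_def\<close>)
  qed
  have sub: "A \<subseteq> verts G" "B \<subseteq> verts G" using adj_in_verts by (auto simp: A_def B_def)
  have cards: "card A = 3" "card B = 3" using uv card_neighbours_3 by (auto simp: A_def B_def)
  have nA: "{w. a \<rightarrow>\<^bsub>G\<^esub> w} = B" if "a \<in> A" for a
    by (rule neighbours_eqI) (use that AB sub cards in auto)
  have nB: "{w. b \<rightarrow>\<^bsub>G\<^esub> w} = A" if "b \<in> B" for b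
    by (rule neighbours_eqI) (use that AB sub cards adj_sym in auto)
  have disj: "A \<inter> B = {}" using AB adj_irrefl by blast
  have "u \<in> A \<union> B" using uv adj_sym by (auto simp: B_def)
  then have V: "A \<union> B = verts G"
    by (rule connected_closed_eq_verts[OF conn]) (use sub nA nB in auto)
  have "arcs_ends G = A \<times> B \<union> B \<times> A"
  proof (intro equalityI subrelI)
    fix a b assume ab: "a \<rightarrow>\<^bsub>G\<^esub> b"
    then have "a \<in> A \<union> B" using V adj_in_verts(1) by metis
    then show "(a, b) \<in> A \<times> B \<union> B \<times> A" using ab nA nB by blast
  next
    fix a b assume "(a, b) \<in> A \<times> B \<union> B \<times> A"
    then show "a \<rightarrow>\<^bsub>G\<^esub> b" using AB adj_sym by blast
  qed
  then show ?thesis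
    using V disj cards graph_axioms unfolding complete_bipartite_digraph_def by metis
qed

text \<open>A singleton is dominated by any neighbour of its vertex, and sizes two and four lead to
  the two complete graphs. Only triangles remain.\<close>

lemma strong_clique_cases:
  assumes C: "strong_clique G C" "v \<in> C"
  obtains "K\<^bsub>4\<^esub> G" | "K\<^bsub>3,3\<^esub> G"
    | a b where "C = {v, a, b}" "a \<noteq> b" "v \<rightarrow>\<^bsub>G\<^esub> a" "v \<rightarrow>\<^bsub>G\<^esub> b" "a \<rightarrow>\<^bsub>G\<^esub> b"
proof -
  have cl: "clique G C" using C by (simp add: strong_clique_def)
  then have v: "v \<in> verts G" using C by (auto simp: clique_def)
  have "card C \<noteq> 0" using clique_le_4[OF cl] C by auto
  then consider "card C = 1" | "card C = 2" | "card C = 3" | "card C = 4"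
    using clique_le_4[OF cl] by linarith
  then show thesis
  proof cases
    case 1
    then have Cv: "C = {v}" using C by (auto simp: card_1_singleton_iff)
    have "{w. v \<rightarrow>\<^bsub>G\<^esub> w} \<noteq> {}"
      using card_neighbours_3[OF v] by (metis card.empty zero_neq_numeral)
    then obtain w where w: "v \<rightarrow>\<^bsub>G\<^esub> w" by auto
    then have "independent_set G {w}"
      using adj_irrefl adj_in_verts by (auto simp: independent_set_def)
    then have False
      by (rule strong_clique_not_dominated[OF C(1)]) (use Cv w in auto)
    then show thesis ..
  next
    case 2
    then show thesis using K33_if_strong_edge C that(2) by (auto simp: card_2_iff)
  next
    case 3
    then have "card (C - {v}) = 2" using C by simp
    then obtain a b where ab: "C - {v} = {a, b}" "a \<noteq> b" by (auto simp: card_2_iff)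
    then have "C = {v, a, b}" "v \<noteq> a" "v \<noteq> b" using C by auto
    with ab(2) cl show thesis by (intro that(3)) (auto simp: clique_def)
  next
    case 4
    then show thesis using K4_if_clique_4[OF cl] that(1) by blast
  qed
qed

end

section \<open>Disjoint triangles and the matching between them\<close>

locale strong_triangle_graph = connected_cubic_graph +
  assumes no_K4: "\<And>C. clique G C \<Longrightarrow> card C \<noteq> 4"
    and strong_triangle: "\<And>v. v \<in> verts G \<Longrightarrow>
      \<exists>a b. strong_clique G {v, a, b} \<and> a \<noteq> b \<and> v \<rightarrow>\<^bsub>G\<^esub> a \<and> v \<rightarrow>\<^bsub>G\<^esub> b \<and> a \<rightarrow>\<^bsub>G\<^esub> b"
begin

lemma neighbours3E:
  assumes "v \<in> verts G" "v \<rightarrow>\<^bsub>G\<^esub> a" "v \<rightarrow>\<^bsub>G\<^esub> b" "a \<noteq> b"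
  obtains c where "c \<noteq> a" "c \<noteq> b" "\<And>w. v \<rightarrow>\<^bsub>G\<^esub> w \<longleftrightarrow> w = a \<or> w = b \<or> w = c"
proof -
  have "card ({w. v \<rightarrow>\<^bsub>G\<^esub> w} - {a, b}) = 1"
    using card_neighbours_3[OF assms(1)] assms finite_neighbours
    by (subst card_Diff_subset) auto
  then obtain c where "{w. v \<rightarrow>\<^bsub>G\<^esub> w} - {a, b} = {c}" by (auto simp: card_1_singleton_iff)
  then show thesis using assms by (intro that[of c]) auto
qed

lemma neighbours3:
  assumes "v \<in> verts G" "v \<rightarrow>\<^bsub>G\<^esub> a" "v \<rightarrow>\<^bsub>G\<^esub> b" "v \<rightarrow>\<^bsub>G\<^esub> c" "a \<noteq> b" "a \<noteq> c" "b \<noteq> c"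
  shows "v \<rightarrow>\<^bsub>G\<^esub> w \<longleftrightarrow> w = a \<or> w = b \<or> w = c"
  using neighbours_eqI[of v "{a, b, c}"] assms by auto

text \<open>In a diamond with middle edge \<open>v a\<close> and tips \<open>b\<close>,
  \<open>c\<close>, the third neighbour \<open>d\<close> of \<open>b\<close> turns out to be
  adjacent to \<open>c\<close> too. All neighbours of \<open>b\<close> and \<open>c\<close> are then
  \<open>v\<close>, \<open>a\<close> and \<open>d\<close>, so \<open>d\<close> lies in no triangle,
  contradicting \<open>strong_triangle\<close>.\<close>

lemma no_diamond:
  assumes v: "strong_clique G {v, a, b}" "v \<in> verts G" "v \<rightarrow>\<^bsub>G\<^esub> a" "v \<rightarrow>\<^bsub>G\<^esub> b" "a \<rightarrow>\<^bsub>G\<^esub> b" "a \<noteq> b"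
    and c: "c \<noteq> a" "c \<noteq> b" "v \<rightarrow>\<^bsub>G\<^esub> c"
  shows "\<not> a \<rightarrow>\<^bsub>G\<^esub> c"
proof
  assume ac: "a \<rightarrow>\<^bsub>G\<^esub> c"
  note s = adj_sym and i = adj_irrefl
  have ne: "v \<noteq> a" "v \<noteq> b" "v \<noteq> c" using v c i by auto
  have V: "a \<in> verts G" "b \<in> verts G" "c \<in> verts G" using v c adj_in_verts by auto
  have Nv: "v \<rightarrow>\<^bsub>G\<^esub> w \<longleftrightarrow> w = a \<or> w = b \<or> w = c" for w
    by (rule neighbours3) (use v c in auto)
  have Na: "a \<rightarrow>\<^bsub>G\<^esub> w \<longleftrightarrow> w = v \<or> w = b \<or> w = c" for w
    by (rule neighbours3) (use V v(5) s[OF v(3)] ac ne c in auto)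
  have bc: "\<not> b \<rightarrow>\<^bsub>G\<^esub> c"
  proof
    assume "b \<rightarrow>\<^bsub>G\<^esub> c"
    then have "clique G {v, a, b, c}"
      using v c ac V s by (auto simp: clique_def)
    then show False using no_K4 ne c v(6) by fastforce
  qed
  obtain d where d: "d \<noteq> v" "d \<noteq> a" "\<And>w. b \<rightarrow>\<^bsub>G\<^esub> w \<longleftrightarrow> w = v \<or> w = a \<or> w = d"
    using neighbours3E[OF V(2) s[OF v(4)] s[OF v(5)] ne(1)] by blast
  have dV: "d \<in> verts G" using d(3) adj_in_verts by blast
  \<comment> \<open>\<open>c\<close> dominates \<open>v\<close> and \<open>a\<close>, while
    \<open>d\<close> dominates \<open>b\<close>, so strength of \<open>{v, a, b}\<close> forces this
    edge.\<close>
  have cd: "c \<rightarrow>\<^bsub>G\<^esub> d"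
  proof (rule ccontr)
    assume "\<not> c \<rightarrow>\<^bsub>G\<^esub> d"
    then have "independent_set G {c, d}"
      using V dV s i by (auto simp: independent_set_def)
    then show False
      by (rule strong_clique_not_dominated[OF v(1)]) (use Nv Na d in auto)
  qed
  have Nc: "c \<rightarrow>\<^bsub>G\<^esub> w \<longleftrightarrow> w = v \<or> w = a \<or> w = d" for w
    by (rule neighbours3) (use V s[OF c(3)] s[OF ac] cd ne d in auto)
  obtain f where f: "\<And>w. d \<rightarrow>\<^bsub>G\<^esub> w \<longleftrightarrow> w = b \<or> w = c \<or> w = f"
    using neighbours3E[OF dV s[OF iffD2[OF d(3)]] s[OF cd]] c(2) by metis
  obtain x y where xy: "x \<noteq> y" "d \<rightarrow>\<^bsub>G\<^esub> x" "d \<rightarrow>\<^bsub>G\<^esub> y" "x \<rightarrow>\<^bsub>G\<^esub> y"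
    using strong_triangle[OF dV] by blast
  have "\<not> d \<rightarrow>\<^bsub>G\<^esub> v" "\<not> d \<rightarrow>\<^bsub>G\<^esub> a" using Nv Na s d bc cd i by metis+
  with xy f Nc d(3) bc s i show False by metis
qed

text \<open>No choice of a strong triangle enters here; \<open>local_structure\<close> identifies
  the partners of \<open>v\<close> with the other two vertices of a strong triangle at
  \<open>v\<close>.\<close>

definition tri :: "'a \<Rightarrow> 'a \<Rightarrow> bool" where
  "tri u v \<longleftrightarrow> u \<rightarrow>\<^bsub>G\<^esub> v \<and> (\<exists>w. u \<rightarrow>\<^bsub>G\<^esub> w \<and> v \<rightarrow>\<^bsub>G\<^esub> w)"

text \<open>That exactly one such neighbour exists comes from the absence of diamonds, see
  \<open>local_structure\<close>.\<close>

definition mate :: "'a \<Rightarrow> 'a" where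
  "mate v = (THE w. v \<rightarrow>\<^bsub>G\<^esub> w \<and> \<not> tri v w)"

lemma tri_sym: "tri u v \<Longrightarrow> tri v u"
  using adj_sym by (auto simp: tri_def)

text \<open>Two uses of \<open>no_diamond\<close>, one for each triangle edge at \<open>v\<close>,
  show that the third neighbour of \<open>v\<close> is adjacent to neither \<open>a\<close> nor
  \<open>b\<close>. The edge to it is thus in no triangle.\<close>

lemma local_structure:
  assumes v: "v \<in> verts G"
  obtains a b where "strong_clique G {v, a, b}" "a \<noteq> b" "a \<noteq> mate v" "b \<noteq> mate v"
    "a \<rightarrow>\<^bsub>G\<^esub> b" "\<And>w. v \<rightarrow>\<^bsub>G\<^esub> w \<longleftrightarrow> w = a \<or> w = b \<or> w = mate v" "\<And>w. tri v w \<longleftrightarrow> w = a \<or> w = b"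
proof -
  obtain a b where ab: "strong_clique G {v, a, b}" "a \<noteq> b" "v \<rightarrow>\<^bsub>G\<^esub> a" "v \<rightarrow>\<^bsub>G\<^esub> b" "a \<rightarrow>\<^bsub>G\<^esub> b"
    using strong_triangle[OF v] by blast
  then obtain c where c: "c \<noteq> a" "c \<noteq> b" "\<And>w. v \<rightarrow>\<^bsub>G\<^esub> w \<longleftrightarrow> w = a \<or> w = b \<or> w = c"
    using neighbours3E[OF v] by metis
  have "\<not> a \<rightarrow>\<^bsub>G\<^esub> c" "\<not> b \<rightarrow>\<^bsub>G\<^esub> c"
    using no_diamond[OF ab(1) v ab(3-5,2)] no_diamond[of v b a c] ab c v adj_sym
    by (auto simp: insert_commute)
  then have tri: "tri v w \<longleftrightarrow> w = a \<or> w = b" for w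
    using c ab adj_sym adj_irrefl unfolding tri_def by metis
  then have "mate v = c" unfolding mate_def using c by auto
  with ab c tri show thesis by (intro that) auto
qed

end

section \<open>Triangles joined by a perfect matching\<close>

lemma verts_F_graph:
  "u \<in> pverts (F_graph n) \<longleftrightarrow> (\<exists>i\<in>{1..n}. u \<in> {Fx i, Fx' i, Fy i, Fy' i, Fz i, Fz' i})"
  by (simp add: F_graph_def)

lemma F_graph_neighbours:
  "(Fx i, t) \<in> parcs (F_graph n) \<longleftrightarrow> i \<in> {1..n} \<and> t \<in> {Fy i, Fz i, Fx' (i mod n + 1)}"
  "(Fy i, t) \<in> parcs (F_graph n) \<longleftrightarrow> i \<in> {1..n} \<and> t \<in> {Fx i, Fz i, Fy' i}"
  "(Fz i, t) \<in> parcs (F_graph n) \<longleftrightarrow> i \<in> {1..n} \<and> t \<in> {Fx i, Fy i, Fz' i}"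
  "(Fy' i, t) \<in> parcs (F_graph n) \<longleftrightarrow> i \<in> {1..n} \<and> t \<in> {Fx' i, Fz' i, Fy i}"
  "(Fz' i, t) \<in> parcs (F_graph n) \<longleftrightarrow> i \<in> {1..n} \<and> t \<in> {Fx' i, Fy' i, Fz i}"
  "(Fx' i, t) \<in> parcs (F_graph n) \<longleftrightarrow>
     i \<in> {1..n} \<and> t \<in> {Fy' i, Fz' i} \<or> (\<exists>j\<in>{1..n}. i = j mod n + 1 \<and> t = Fx j)"
  by (auto simp: F_graph_def symcl_def image_iff)

text \<open>An abstraction of the graph in which adjacency is split into \<open>tri\<close> (same
  triangle, distinct vertices) and the matching \<open>mate\<close>. Strength of the triangles
  survives only as \<open>mates_tri\<close>.\<close>

locale matched_triangles =
  fixes V :: "'a set" and tri :: "'a \<Rightarrow> 'a \<Rightarrow> bool" and mate :: "'a \<Rightarrow> 'a"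
  assumes finite_V: "finite V"
    and mate_in: "v \<in> V \<Longrightarrow> mate v \<in> V"
    and mate_mate: "v \<in> V \<Longrightarrow> mate (mate v) = v"
    and mate_neq: "v \<in> V \<Longrightarrow> mate v \<noteq> v"
    and tri_in: "tri u v \<Longrightarrow> u \<in> V"
    and tri_sym: "tri u v \<Longrightarrow> tri v u"
    and tri_irrefl: "\<not> tri v v"
    and tri_trans: "tri u v \<Longrightarrow> tri u w \<Longrightarrow> v \<noteq> w \<Longrightarrow> tri v w"
    and tri_two: "v \<in> V \<Longrightarrow> \<exists>a b. a \<noteq> b \<and> (\<forall>w. tri v w \<longleftrightarrow> w = a \<or> w = b)"
    and not_tri_mate: "v \<in> V \<Longrightarrow> \<not> tri v (mate v)"
    and mates_tri: "tri v a \<Longrightarrow> tri v b \<Longrightarrow> a \<noteq> b \<Longrightarrow>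
      tri (mate v) (mate a) \<or> tri (mate v) (mate b) \<or> tri (mate a) (mate b)"
begin

text \<open>
  \<open>block v a b x\<close>: the triangles \<open>v a b\<close> and \<open>x (mate a) (mate b)\<close> form one of the
  six-vertex pieces from which the graphs \<^term>\<open>F_graph n\<close> are built, \<open>v\<close> and \<open>x\<close> being its ends.
\<close>

definition block :: "'a \<Rightarrow> 'a \<Rightarrow> 'a \<Rightarrow> 'a \<Rightarrow> bool" where
  "block v a b x \<longleftrightarrow> a \<noteq> b \<and> tri v a \<and> tri v b \<and> tri (mate a) (mate b)
     \<and> tri x (mate a) \<and> tri x (mate b)"

definition ends :: "'a set" where
  "ends = {v. \<exists>a b x. block v a b x}"

section \<open>Elementary properties of triangles and blocks\<close>

lemma tri_in': "tri u v \<Longrightarrow> v \<in> V"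
  using tri_in tri_sym by blast

lemma mate_inj: "u \<in> V \<Longrightarrow> v \<in> V \<Longrightarrow> mate u = mate v \<longleftrightarrow> u = v"
  using mate_mate by metis

lemma tri_third:
  assumes "tri v a" "tri v b" "a \<noteq> b"
  shows "tri v w \<longleftrightarrow> w = a \<or> w = b"
  using tri_two[OF tri_in[OF assms(1)]] assms by metis

lemma third_ex:
  assumes "tri a b"
  obtains x where "tri x a" "tri x b"
proof -
  obtain c d where "c \<noteq> d" "\<And>w. tri a w \<longleftrightarrow> w = c \<or> w = d"
    using tri_two[OF tri_in[OF assms]] by blast
  then obtain x where "tri a x" "x \<noteq> b" using assms by metis
  then show thesis using that tri_trans[OF \<open>tri a x\<close> assms] tri_sym by blast
qed

lemma third_unique:
  assumes "tri a b" "tri x a" "tri x b" "tri y a" "tri y b"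
  shows "x = y"
proof -
  have "b \<noteq> x" using assms tri_irrefl by metis
  then have "tri a w \<longleftrightarrow> w = b \<or> w = x" for w
    using tri_third[of a b x] assms tri_sym by blast
  then show ?thesis using assms tri_sym tri_irrefl by metis
qed

lemma block_in_V: "block v a b x \<Longrightarrow> v \<in> V \<and> a \<in> V \<and> b \<in> V \<and> x \<in> V"
  unfolding block_def using tri_in tri_in' by blast

text \<open>As \<open>mate\<close> is an involution, a block can be read from either end.\<close>

lemma block_sym:
  assumes "block v a b x"
  shows "block x (mate a) (mate b) v"
proof -
  have "mate (mate a) = a" "mate (mate b) = b" "mate a \<noteq> mate b" "tri a b"
    using block_in_V[OF assms] assms mate_mate mate_inj tri_trans unfolding block_def by metis+
  then show ?thesis using assms by (simp add: block_def)
qed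

lemma block_triangle:
  assumes "block v a b x"
  shows "tri v w \<longleftrightarrow> w = a \<or> w = b" "tri a w \<longleftrightarrow> w = v \<or> w = b" "tri b w \<longleftrightarrow> w = v \<or> w = a"
proof -
  have B: "a \<noteq> b" "tri v a" "tri v b" using assms by (simp_all add: block_def)
  then have ab: "tri a b" "v \<noteq> a" "v \<noteq> b" using tri_trans tri_irrefl by metis+
  show "tri v w \<longleftrightarrow> w = a \<or> w = b" by (rule tri_third[OF B(2,3,1)])
  show "tri a w \<longleftrightarrow> w = v \<or> w = b" by (rule tri_third[OF tri_sym[OF B(2)] ab(1,3)])
  show "tri b w \<longleftrightarrow> w = v \<or> w = a"
    by (rule tri_third[OF tri_sym[OF B(3)] tri_sym[OF ab(1)] ab(2)])
qed

text \<open>The triangle of \<open>v\<close> determines \<open>a\<close> and \<open>b\<close> up to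
  order, hence the opposite triangle and its third vertex. This makes \<open>far\<close> well
  defined.\<close>

lemma block_unique:
  assumes "block v a b x" "block v a' b' x'"
  shows "x = x'"
proof -
  have "a' = a \<and> b' = b \<or> a' = b \<and> b' = a"
    using assms block_triangle(1) unfolding block_def by metis
  then show ?thesis
    using assms third_unique tri_sym unfolding block_def by metis
qed

lemma in_ends_iff: "v \<in> ends \<longleftrightarrow> (\<exists>a b. a \<noteq> b \<and> tri v a \<and> tri v b \<and> tri (mate a) (mate b))"
  unfolding ends_def block_def using third_ex by blast

lemma ends_subset_V: "ends \<subseteq> V"
  unfolding ends_def using block_in_V by blast

text \<open>Otherwise \<open>mate a\<close> would lie in the triangle of \<open>v\<close>, which is
  also that of \<open>a\<close>.\<close>

lemma block_ends_neq:
  assumes "block v a b x"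
  shows "v \<noteq> x" "\<not> tri v x"
proof -
  have m: "mate a \<noteq> v" "mate a \<noteq> a" "mate a \<noteq> b" "\<not> tri v (mate a)"
    using block_in_V[OF assms] assms not_tri_mate mate_neq tri_sym block_triangle(1) tri_trans
    unfolding block_def by metis+
  then show "v \<noteq> x" using assms unfolding block_def by blast
  show "\<not> tri v x"
  proof
    assume "tri v x"
    then have "tri x v" by (rule tri_sym)
    then have "tri v (mate a)" using m tri_trans assms unfolding block_def by metis
    with m show False by blast
  qed
qed

lemma ex_end:
  assumes "v \<in> V"
  shows "\<exists>x. x \<in> ends"
proof -
  obtain a b where ab: "a \<noteq> b" "tri v a" "tri v b" using tri_two[OF assms] by metis
  then have "tri a b" "tri a v" "tri b v" "tri b a" "v \<noteq> a" "v \<noteq> b"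
    using tri_trans tri_sym tri_irrefl by metis+
  then show ?thesis using mates_tri[OF ab(2,3,1)] ab unfolding in_ends_iff by metis
qed

text \<open>Apply \<open>mates_tri\<close> to the triangle of \<open>mate v\<close>. If the tri pair
  of mates avoids \<open>v\<close>, then \<open>mate v\<close> is an end by definition. Otherwise
  one of the other mates is \<open>a\<close> or \<open>b\<close>, so the triangle of
  \<open>mate v\<close> is the opposite triangle of the block at \<open>v\<close>, and
  \<open>mate v\<close> is its far end \<open>x\<close>.\<close>

lemma mate_end:
  assumes "v \<in> ends"
  shows "mate v \<in> ends"
proof -
  obtain a b x where B: "block v a b x" using assms by (auto simp: ends_def)
  then have V: "v \<in> V" "a \<in> V" "b \<in> V" "x \<in> V" using block_in_V by auto
  obtain c d where cd: "c \<noteq> d" "\<And>w. tri (mate v) w \<longleftrightarrow> w = c \<or> w = d"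
    using tri_two[OF mate_in[OF V(1)]] by metis
  have cdV: "c \<in> V" "d \<in> V" using cd tri_in' by blast+
  consider "tri (mate c) (mate d)" | w where "w \<in> {c, d}" "tri v (mate w)"
    using mates_tri[of "mate v" c d] cd mate_mate[OF V(1)] by auto
  then show ?thesis
  proof cases
    case 1
    then show ?thesis using cd unfolding in_ends_iff by blast
  next
    case (2 w)
    then have "mate w = a \<or> mate w = b" "w \<in> V" using block_triangle(1)[OF B] cdV by auto
    then have "w = mate a \<or> w = mate b" using mate_mate by metis
    moreover have "tri (mate v) w" using 2(1) cd by blast
    moreover have "mate v \<noteq> mate a" "mate v \<noteq> mate b"
      using mate_inj V B tri_irrefl unfolding block_def by metis+
    ultimately have "tri (mate v) (mate a)" "tri (mate v) (mate b)"
      using B tri_trans tri_sym unfolding block_def by metis+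
    then have "mate v = x" using third_unique B unfolding block_def by blast
    then show ?thesis using block_sym[OF B] by (auto simp: ends_def)
  qed
qed

text \<open>With two ends \<open>v\<close>, \<open>u\<close> and third vertex \<open>c\<close>, both
  \<open>mate v\<close> and \<open>mate u\<close> share a triangle with \<open>mate c\<close>. So
  the three mates form one triangle, and the block is a triangular prism.\<close>

lemma tri_ends_prism:
  assumes B: "block v a b x" and u: "u \<in> ends" "tri v u"
  shows "x = mate v"
proof -
  have V: "v \<in> V" "a \<in> V" "b \<in> V" "x \<in> V" using block_in_V[OF B] by auto
  obtain c where c: "c \<noteq> u" "\<And>w. tri v w \<longleftrightarrow> w = u \<or> w = c" and cab: "{u, c} = {a, b}"
    using block_triangle(1)[OF B] u(2) B unfolding block_def by (metis doubleton_eq_iff)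
  obtain p q y where P: "block u p q y" using u(1) by (auto simp: ends_def)
  have "tri u v" "tri u c" "v \<noteq> c"
    using c u tri_sym tri_trans tri_irrefl by metis+
  then have "v = p \<or> v = q" "c = p \<or> c = q" "v \<noteq> c"
    using block_triangle(1)[OF P] by auto
  then have "{p, q} = {v, c}" by auto
  then have "tri (mate v) (mate c)"
    using P tri_sym unfolding block_def by (metis doubleton_eq_iff)
  moreover have "tri (mate u) (mate c)"
    using B cab tri_sym unfolding block_def by (metis doubleton_eq_iff)
  moreover have "mate u \<noteq> mate v"
    using mate_inj u V tri_in' tri_irrefl by metis
  ultimately have "tri (mate v) (mate u)" "tri (mate v) (mate c)"
    using tri_trans tri_sym by metis+
  then have "tri (mate v) (mate a)" "tri (mate v) (mate b)"
    using cab by (metis doubleton_eq_iff)+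
  then show ?thesis using third_unique B unfolding block_def by blast
qed

section \<open>Stepping from one block to the next\<close>

definition far :: "'a \<Rightarrow> 'a" where
  "far v = (THE x. \<exists>a b. block v a b x)"

text \<open>The identity outside \<open>ends\<close> makes the map injective on the whole type, so
  that its orbits can be handled with \<open>funpow_inj_finite\<close>.\<close>

definition next_end :: "'a \<Rightarrow> 'a" where
  "next_end v = (if v \<in> ends then mate (far v) else v)"

lemma far_eq: "block v a b x \<Longrightarrow> far v = x"
  unfolding far_def using block_unique by blast

lemma block_far: "v \<in> ends \<Longrightarrow> \<exists>a b. block v a b (far v)"
  unfolding ends_def using far_eq by blast

lemma far_end: "v \<in> ends \<Longrightarrow> far v \<in> ends"
  using block_far block_sym unfolding ends_def by blast

lemma far_far: "v \<in> ends \<Longrightarrow> far (far v) = v"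
  using block_far block_sym far_eq by blast

lemma far_neq:
  assumes "v \<in> ends"
  shows "far v \<noteq> v" "\<not> tri v (far v)"
  using block_far[OF assms] by (auto dest: block_ends_neq)

lemma end_in_V: "v \<in> ends \<Longrightarrow> v \<in> V"
  using ends_subset_V by blast

lemma next_end: "v \<in> ends \<Longrightarrow> next_end v \<in> ends"
  by (simp add: next_end_def mate_end far_end)

lemma inj_next_end: "inj next_end"
proof (rule injI)
  fix u v assume eq: "next_end u = next_end v"
  show "u = v"
  proof (cases "u \<in> ends \<and> v \<in> ends")
    case True
    then have "mate (far u) = mate (far v)" using eq by (simp add: next_end_def)
    then have "far u = far v" using mate_inj True far_end end_in_V by blast
    then show ?thesis using far_far True by metis
  next
    case False
    then show ?thesis using eq next_end by (auto simp: next_end_def split: if_splits)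
  qed
qed

section \<open>The cyclic sequence of ends starting at \<open>w0\<close>\<close>

context
  fixes w0 :: 'a
  assumes w0: "w0 \<in> ends"
begin

definition end_seq :: "nat \<Rightarrow> 'a" where
  "end_seq i = (next_end ^^ i) w0"

lemma end_seq_end: "end_seq i \<in> ends"
  by (induction i) (simp_all add: end_seq_def w0 next_end)

lemma end_seq_Suc: "end_seq (Suc i) = mate (far (end_seq i))"
  using end_seq_end[of i] by (simp add: end_seq_def next_end_def)

lemma end_seq_add: "end_seq (i + j) = (next_end ^^ i) (end_seq j)"
  by (simp add: end_seq_def funpow_add)

text \<open>
  \<open>far\<close> and \<open>mate\<close> are fixed-point free involutions; were \<open>far (end_seq i)\<close> equal to
  \<open>end_seq (i + d)\<close>, then so would \<open>far (end_seq (i + 1))\<close> and \<open>end_seq (i + 1 + (d - 2))\<close>,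
  which ends in a fixed point of one of them.
\<close>

lemma far_end_seq_neq_add: "far (end_seq i) \<noteq> end_seq (i + d)"
proof (induction d arbitrary: i rule: less_induct)
  case (less d)
  show ?case
  proof
    assume eq: "far (end_seq i) = end_seq (i + d)"
    consider "d = 0" | "d = 1" | e where "d = Suc (Suc e)"
      by (metis One_nat_def not0_implies_Suc)
    then show False
    proof cases
      case 1
      then show False using eq far_neq end_seq_end by auto
    next
      case 2
      then have "far (end_seq i) = mate (far (end_seq i))" using eq end_seq_Suc by simp
      then show False using mate_neq far_end end_seq_end end_in_V by metis
    next
      case (3 e)
      then have "end_seq (Suc i) = mate (mate (far (end_seq (i + Suc e))))" using eq end_seq_Suc by simp
      also have "\<dots> = far (end_seq (i + Suc e))" using mate_mate far_end end_seq_end end_in_V by blast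
      finally have "far (end_seq (Suc i)) = end_seq (Suc i + e)" using far_far end_seq_end by simp
      then show False using less.IH[of e "Suc i"] 3 by simp
    qed
  qed
qed

definition period :: nat where
  "period = (LEAST n. 0 < n \<and> end_seq n = w0)"

text \<open>The orbit stays in the finite set \<open>V\<close>, and an injective map with a finite
  orbit returns to its starting point.\<close>

lemma period: "0 < period" "end_seq period = w0"
proof -
  have "{y. \<exists>n. y = (next_end ^^ n) w0} \<subseteq> V"
    using end_seq_end end_in_V unfolding end_seq_def by auto
  then have "finite {y. \<exists>n. y = (next_end ^^ n) w0}"
    using finite_V finite_subset by blast
  from funpow_inj_finite[OF inj_next_end this] have "\<exists>n. 0 < n \<and> end_seq n = w0"
    unfolding end_seq_def by metis
  then have "0 < period \<and> end_seq period = w0"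
    unfolding period_def by (rule LeastI_ex)
  then show "0 < period" "end_seq period = w0" by auto
qed

lemma end_seq_diff:
  assumes "end_seq i = end_seq j" "i \<le> j"
  shows "end_seq (j - i) = w0"
proof -
  have "(next_end ^^ i) (end_seq (j - i)) = (next_end ^^ i) w0"
    using assms end_seq_add[of i "j - i"] by (simp add: end_seq_def)
  then show ?thesis using inj_fn[OF inj_next_end] by (simp add: inj_eq)
qed

lemma period_le: "end_seq i = end_seq j \<Longrightarrow> i < j \<Longrightarrow> period \<le> j - i"
  unfolding period_def using end_seq_diff[of i j] by (intro Least_le) simp

lemma end_seq_inj:
  assumes "end_seq i = end_seq j" "i \<in> {1..period}" "j \<in> {1..period}"
  shows "i = j"
  using period_le[of i j] period_le[of j i] assms by (cases i j rule: linorder_cases) auto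

lemma end_seq_period: "end_seq (i + period * k) = end_seq i"
proof (induction k)
  case (Suc k)
  have "end_seq (i + period * Suc k) = end_seq (i + period * k + period)" by (simp add: ac_simps)
  also have "\<dots> = end_seq (i + period * k + 0)"
    unfolding end_seq_add period(2) by (simp add: end_seq_def)
  finally show ?case using Suc by simp
qed simp

text \<open>Blocks are numbered from 1 to \<open>period\<close>, as in \<open>F_graph\<close>. At
  \<open>i = period\<close> the index wraps to 1, which agrees with \<open>period + 1\<close> by
  periodicity.\<close>

lemma end_seq_mod: "i \<in> {1..period} \<Longrightarrow> end_seq (i mod period + 1) = mate (far (end_seq i))"
  using end_seq_period[of 1 1] end_seq_Suc[of i] by (cases "i = period") auto

text \<open>Adding a multiple of \<open>period\<close> to \<open>j\<close> lifts it to at least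
  \<open>i\<close>, which reduces the claim to \<open>far_end_seq_neq_add\<close>.\<close>

lemma far_end_seq_neq: "far (end_seq i) \<noteq> end_seq j"
proof -
  have "i \<le> j + period * i" using period(1) by (cases period) auto
  then show ?thesis
    using far_end_seq_neq_add[of i "j + period * i - i"] end_seq_period[of j i] by simp
qed

text \<open>In a prism the edge leaving the far end leads back to the starting end, so
  \<open>next_end\<close> fixes \<open>end_seq i\<close>.\<close>

lemma prism_if_period_1:
  assumes "far v = mate v" "v = end_seq i \<or> v = far (end_seq i)"
  shows "period = 1"
proof -
  have "v \<in> V" using assms end_seq_end far_end end_in_V by auto
  then have "end_seq i = end_seq (Suc i)"
    using assms end_seq_Suc[of i] mate_mate far_far end_seq_end by metis
  then show ?thesis using period_le[of i "Suc i"] period(1) by simp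
qed

section \<open>Separation of the triangles and the embedding of
  \<open>F_graph period\<close>\<close>

lemma tri_end_far: "v \<in> ends \<Longrightarrow> u \<in> ends \<Longrightarrow> tri v u \<Longrightarrow> far v = mate v"
  using tri_ends_prism block_far by blast

text \<open>Each vertex is represented by the end of the triangle it will be mapped into, so that
  triangles can be compared through their ends.\<close>

primrec rep :: "F_vertex \<Rightarrow> 'a" where
  "rep (Fx i) = far (end_seq i)"
| "rep (Fy i) = far (end_seq i)"
| "rep (Fz i) = far (end_seq i)"
| "rep (Fx' i) = end_seq i"
| "rep (Fy' i) = end_seq i"
| "rep (Fz' i) = end_seq i"

text \<open>Two ends in one triangle make the block a prism, and then \<open>period = 1\<close>
  leaves a single index. For an end and its own far end, \<open>far_neq\<close> rules out a common
  triangle.\<close>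

lemma ends_separated:
  assumes ij: "i \<in> {1..period}" "j \<in> {1..period}"
  shows "end_seq i = end_seq j \<or> tri (end_seq i) (end_seq j) \<longleftrightarrow> i = j"
    and "far (end_seq i) = far (end_seq j) \<or> tri (far (end_seq i)) (far (end_seq j)) \<longleftrightarrow> i = j"
    and "\<not> tri (end_seq i) (far (end_seq j))" "\<not> tri (far (end_seq i)) (end_seq j)"
proof -
  have one: "i = j" if "period = 1" using that ij by simp
  have "i = j" if "tri (end_seq i) (end_seq j)"
    by (rule one, rule prism_if_period_1[of "end_seq i" i]) (use tri_end_far that end_seq_end in blast)+
  then show "end_seq i = end_seq j \<or> tri (end_seq i) (end_seq j) \<longleftrightarrow> i = j"
    using end_seq_inj[OF _ ij] tri_irrefl by blast
  have "i = j" if "tri (far (end_seq i)) (far (end_seq j))"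
    by (rule one, rule prism_if_period_1[of "far (end_seq i)" i])
      (use tri_end_far that end_seq_end far_end in blast)+
  moreover have "i = j" if "far (end_seq i) = far (end_seq j)"
    using that end_seq_inj[OF _ ij] far_far end_seq_end by metis
  ultimately show "far (end_seq i) = far (end_seq j) \<or> tri (far (end_seq i)) (far (end_seq j)) \<longleftrightarrow> i = j"
    using tri_irrefl by blast
  have no: "\<not> tri (end_seq k) (far (end_seq l))" if "k = i \<and> l = j \<or> k = j \<and> l = i" for k l
  proof
    assume t: "tri (end_seq k) (far (end_seq l))"
    have "i = j"
      by (rule one, rule prism_if_period_1[of "end_seq k" k])
        (use tri_end_far t end_seq_end far_end in blast)+
    then show False using that t far_neq(2) end_seq_end by blast
  qed
  show "\<not> tri (end_seq i) (far (end_seq j))" using no[of i j] by simp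
  show "\<not> tri (far (end_seq i)) (end_seq j)" using no[of j i] tri_sym by blast
qed

text \<open>Block number \<open>i\<close> receives the six vertices of index \<open>i\<close>, and
  the matching edges between far ends and next ends become the edges from \<open>Fx i\<close> to
  \<open>Fx' (i mod n + 1)\<close>. The last clause also says that the image is closed under
  \<open>tri\<close> and \<open>mate\<close>; that it is everything follows later from
  connectedness.\<close>

lemma F_graph_embedding:
  obtains g where "inj_on g (pverts (F_graph period))" "g ` pverts (F_graph period) \<subseteq> V"
    "\<And>u v. u \<in> pverts (F_graph period) \<Longrightarrow>
       tri (g u) v \<or> v = mate (g u) \<longleftrightarrow> (\<exists>t. (u, t) \<in> parcs (F_graph period) \<and> v = g t)"
proof -
  have "\<exists>a b. block (end_seq i) a b (far (end_seq i))" for i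
    using block_far[OF end_seq_end] .
  then obtain a b where B: "\<And>i. block (end_seq i) (a i) (b i) (far (end_seq i))" by metis
  define g where "g u = (case u of Fx i \<Rightarrow> far (end_seq i) | Fy i \<Rightarrow> mate (a i) | Fz i \<Rightarrow> mate (b i)
    | Fx' i \<Rightarrow> end_seq i | Fy' i \<Rightarrow> a i | Fz' i \<Rightarrow> b i)" for u
  have g: "g (Fx i) = far (end_seq i)" "g (Fy i) = mate (a i)" "g (Fz i) = mate (b i)"
    "g (Fx' i) = end_seq i" "g (Fy' i) = a i" "g (Fz' i) = b i" for i
    by (simp_all add: g_def)
  note B' = block_sym[OF B]
  have V: "end_seq i \<in> V" "a i \<in> V" "b i \<in> V" "far (end_seq i) \<in> V" for i
    using block_in_V[OF B[of i]] by auto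
  note mm = V[THEN mate_mate]
  have gV: "g u \<in> V" for u
    by (cases u) (simp_all add: g V mate_in)
  have rep: "rep u = g u \<or> tri (rep u) (g u)" for u
    by (cases u) (simp_all add: g block_triangle[OF B] block_triangle[OF B'])
  have ne: "end_seq i \<noteq> a i" "end_seq i \<noteq> b i" "a i \<noteq> b i"
    "far (end_seq i) \<noteq> mate (a i)" "far (end_seq i) \<noteq> mate (b i)" "mate (a i) \<noteq> mate (b i)" for i
    using B[of i] B'[of i] tri_irrefl unfolding block_def by metis+
  show thesis
  proof
    show "inj_on g (pverts (F_graph period))"
    proof (rule inj_onI)
      fix u t assume ut: "u \<in> pverts (F_graph period)" "t \<in> pverts (F_graph period)" "g u = g t"
      \<comment> \<open>Equal images lie in the same triangle, so their representing ends coincide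
        or are \<open>tri\<close>; \<open>ends_separated\<close> then forces equal indices and the
        same side of the block.\<close>
      then have r: "rep u = rep t \<or> tri (rep u) (rep t)"
        using rep[of u] rep[of t] tri_sym tri_trans by metis
      from ut(1) obtain i where i: "i \<in> {1..period}" "u \<in> {Fx i, Fx' i, Fy i, Fy' i, Fz i, Fz' i}"
        unfolding verts_F_graph by blast
      from ut(2) obtain j where j: "j \<in> {1..period}" "t \<in> {Fx j, Fx' j, Fy j, Fy' j, Fz j, Fz' j}"
        unfolding verts_F_graph by blast
      note sep = ends_separated[OF i(1) j(1)] far_end_seq_neq far_end_seq_neq[symmetric]
      from r i(2) j(2) have "i = j" using sep by auto
      then show "u = t"
        using r i(2) j(2) ut(3) sep ne[of j] ne[of j, symmetric] by (auto simp: g)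
    qed
  next
    show "g ` pverts (F_graph period) \<subseteq> V" using gV by blast
  next
    fix u v assume "u \<in> pverts (F_graph period)"
    then obtain i where i: "i \<in> {1..period}" "u \<in> {Fx i, Fx' i, Fy i, Fy' i, Fz i, Fz' i}"
      unfolding verts_F_graph by blast
    show "tri (g u) v \<or> v = mate (g u) \<longleftrightarrow> (\<exists>t. (u, t) \<in> parcs (F_graph period) \<and> v = g t)"
    proof (cases "u = Fx' i")
      case False
      then show ?thesis
        using i end_seq_mod[OF i(1)]
        by (auto simp: F_graph_neighbours g block_triangle[OF B] block_triangle[OF B'] mm
            conj_disj_distribR ex_disj_distrib)
    next
      case True
      have mate_w: "mate (end_seq i) = far (end_seq j)" if "j \<in> {1..period}" "i = j mod period + 1" for j
        using end_seq_mod[OF that(1)] that(2) mm(4)[of j] by simp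
      \<comment> \<open>The cyclic predecessor of \<open>i\<close> in \<open>{1..period}\<close>:
        the matching edge at \<open>Fx' i\<close> comes from the block before it.\<close>
      define j where "j = (if i = 1 then period else i - 1)"
      have j: "j \<in> {1..period}" "i = j mod period + 1"
        using i(1) by (auto simp: j_def)
      have "(\<exists>t. (Fx' i, t) \<in> parcs (F_graph period) \<and> v = g t) \<longleftrightarrow>
        v = a i \<or> v = b i \<or> (\<exists>j\<in>{1..period}. i = j mod period + 1 \<and> v = far (end_seq j))"
        using i(1) by (simp add: F_graph_neighbours g conj_disj_distribR ex_disj_distrib) (metis g(1))
      moreover have "(\<exists>j\<in>{1..period}. i = j mod period + 1 \<and> v = far (end_seq j)) \<longleftrightarrow> v = mate (end_seq i)"
        using mate_w j by metis
      ultimately show ?thesis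
        using True by (simp add: g block_triangle[OF B])
    qed
  qed
qed

end

end

section \<open>Isomorphisms and the classification\<close>

text \<open>The isomorphism is the inverse of \<open>g\<close>, since embeddings are built from the
  concrete graph into \<open>G\<close>. Arcs go to the pairs of images of their endpoints; this is
  injective because there are no parallel arcs.\<close>

lemma (in nomulti_digraph) digraph_iso_with_projI:
  assumes inj: "inj_on g (pverts H)" and im: "g ` pverts H = verts G"
    and H: "parcs H \<subseteq> pverts H \<times> pverts H"
    and adj: "\<And>u v. u \<in> pverts H \<Longrightarrow> g u \<rightarrow>\<^bsub>G\<^esub> v \<longleftrightarrow> (\<exists>t. (u, t) \<in> parcs H \<and> v = g t)"
  shows "digraph_iso G (with_proj H)"
proof -
  define f where "f = the_inv_into (pverts H) g"
  have fg: "f (g u) = u" if "u \<in> pverts H" for u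
    using the_inv_into_f_f[OF inj that] by (simp add: f_def)
  have gf: "g (f v) = v" "f v \<in> pverts H" if "v \<in> verts G" for v
    using f_the_inv_into_f[OF inj] the_inv_into_into[OF inj _ subset_refl] that im
    by (auto simp: f_def)
  define arc where "arc = (\<lambda>(u, v). (f u, f v)) \<circ> arc_to_ends G"
  have inj_f: "inj_on f (verts G)" using gf by (metis inj_onI)
  have inj_arc: "inj_on arc (arcs G)"
  proof (rule inj_onI)
    fix d e assume de: "d \<in> arcs G" "e \<in> arcs G" "arc d = arc e"
    then have "f (tail G d) = f (tail G e)" "f (head G d) = f (head G e)"
      by (simp_all add: arc_def arc_to_ends_def)
    then have "tail G d = tail G e" "head G d = head G e"
      using inj_f de by (simp_all add: inj_on_eq_iff)
    then show "d = e" using no_multi_arcs de by (simp add: arc_to_ends_def)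
  qed
  have "arc ` arcs G = (\<lambda>(u, v). (f u, f v)) ` arcs_ends G"
    by (simp add: arc_def arcs_ends_def image_comp)
  also have "\<dots> = parcs H"
  proof (intro equalityI subsetI)
    fix e assume "e \<in> (\<lambda>(u, v). (f u, f v)) ` arcs_ends G"
    then obtain u v where uv: "u \<rightarrow>\<^bsub>G\<^esub> v" "e = (f u, f v)" by auto
    then have V: "u \<in> verts G" "v \<in> verts G" using adj_in_verts by auto
    then obtain t where "(f u, t) \<in> parcs H" "v = g t"
      using adj[of "f u" v] gf uv by auto
    then show "e \<in> parcs H" using fg H uv(2) by auto
  next
    fix e assume e: "e \<in> parcs H"
    obtain s t where st: "e = (s, t)" by fastforce
    then have "s \<in> pverts H" "t \<in> pverts H" using e H by auto
    moreover from this have "g s \<rightarrow>\<^bsub>G\<^esub> g t" using adj e st by blast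
    ultimately show "e \<in> (\<lambda>(u, v). (f u, f v)) ` arcs_ends G"
      using fg st by (force intro: rev_image_eqI)
  qed
  finally have arcs: "arc ` arcs G = parcs H" .
  have "f ` verts G = pverts H"
    using im fg gf by force
  with arcs have "with_proj H = app_iso \<lparr>iso_verts = f, iso_arcs = arc, iso_head = snd, iso_tail = fst\<rparr> G"
    by (simp add: with_proj_def app_iso_def)
  moreover have "digraph_isomorphism \<lparr>iso_verts = f, iso_arcs = arc, iso_head = snd, iso_tail = fst\<rparr>"
    using inj_f inj_arc wf_digraph
    by (simp add: digraph_isomorphism_def arc_def arc_to_ends_def)
  ultimately show ?thesis unfolding digraph_iso_def by blast
qed

lemma (in wf_digraph) digraph_iso_with_projE:
  assumes "digraph_iso G (with_proj H)"
  obtains f where "bij_betw f (verts G) (pverts H)"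
    "\<And>u v. u \<in> verts G \<Longrightarrow> v \<in> verts G \<Longrightarrow> u \<rightarrow>\<^bsub>G\<^esub> v \<longleftrightarrow> (f u, f v) \<in> parcs H"
proof -
  obtain h where h: "digraph_isomorphism h" "with_proj H = app_iso h G"
    using assms unfolding digraph_iso_def by blast
  have inj: "inj_on (iso_verts h) (verts G)" using digraph_isomorphism_inj_on_verts[OF h(1)] .
  have V: "iso_verts h ` verts G = pverts H"
    using arg_cong[OF h(2), of verts] by simp
  have A: "parcs H = (\<lambda>(u, v). (iso_verts h u, iso_verts h v)) ` arcs_ends G"
    using arg_cong[OF h(2), of arcs_ends] arcs_ends_app_iso_eq[OF h(1)] by simp
  show thesis
  proof
    show "bij_betw (iso_verts h) (verts G) (pverts H)" using inj V by (simp add: bij_betw_def)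
  next
    fix u v assume uv: "u \<in> verts G" "v \<in> verts G"
    show "u \<rightarrow>\<^bsub>G\<^esub> v \<longleftrightarrow> (iso_verts h u, iso_verts h v) \<in> parcs H"
    proof
      assume "(iso_verts h u, iso_verts h v) \<in> parcs H"
      then obtain a b where "a \<rightarrow>\<^bsub>G\<^esub> b" "iso_verts h u = iso_verts h a" "iso_verts h v = iso_verts h b"
        unfolding A by auto
      moreover from this(1) have "a \<in> verts G" "b \<in> verts G" using adj_in_verts by auto
      ultimately show "u \<rightarrow>\<^bsub>G\<^esub> v" using inj uv by (simp add: inj_on_eq_iff)
    qed (auto simp: A)
  qed
qed

section \<open>Localizability of the listed graphs\<close>

context graph
begin

text \<open>Pulls a labelling of \<open>H\<close> back along the isomorphism, so that the
  certificates of \<open>localizableI\<close> can be checked in the concrete graph.\<close>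

lemma localizable_isoI:
  assumes iso: "digraph_iso G (with_proj H)"
    and cl: "\<And>u v. u \<in> pverts H \<Longrightarrow> v \<in> pverts H \<Longrightarrow> l u = l v \<Longrightarrow> u \<noteq> v \<Longrightarrow> (u, v) \<in> parcs H"
    and ex: "\<And>v. v \<in> pverts H \<Longrightarrow> \<exists>p\<in>pverts H. \<exists>q\<in>pverts H. l p = l v \<and> l q = l v \<and>
      (\<forall>p' q'. (p, p') \<in> parcs H \<longrightarrow> (q, q') \<in> parcs H \<longrightarrow> l p' \<noteq> l v \<longrightarrow> l q' \<noteq> l v \<longrightarrow> (p', q') \<in> parcs H)"
  shows "localizable G"
proof -
  obtain f where f: "bij_betw f (verts G) (pverts H)"
    and adj: "\<And>u v. u \<in> verts G \<Longrightarrow> v \<in> verts G \<Longrightarrow> u \<rightarrow>\<^bsub>G\<^esub> v \<longleftrightarrow> (f u, f v) \<in> parcs H"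
    using digraph_iso_with_projE[OF iso] by blast
  have fV: "f u \<in> pverts H" if "u \<in> verts G" for u using f that by (auto simp: bij_betw_def)
  show ?thesis
  proof (rule localizableI[of "\<lambda>v. l (f v)"])
    fix u v assume "u \<in> verts G" "v \<in> verts G" "l (f u) = l (f v)" "u \<noteq> v"
    moreover from this have "f u \<noteq> f v" using f by (auto simp: bij_betw_def inj_on_eq_iff)
    ultimately show "u \<rightarrow>\<^bsub>G\<^esub> v" using adj cl fV by simp
  next
    fix v assume "v \<in> verts G"
    from ex[OF fV[OF this]] obtain p q where pq: "p \<in> pverts H" "q \<in> pverts H"
      "l p = l (f v)" "l q = l (f v)"
      and H: "\<And>p' q'. (p, p') \<in> parcs H \<Longrightarrow> (q, q') \<in> parcs H \<Longrightarrow>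
        l p' \<noteq> l (f v) \<Longrightarrow> l q' \<noteq> l (f v) \<Longrightarrow> (p', q') \<in> parcs H"
      by (elim bexE conjE) simp
    have "p \<in> f ` verts G" "q \<in> f ` verts G" using pq f by (simp_all add: bij_betw_def)
    then obtain x y where xy: "x \<in> verts G" "y \<in> verts G" "f x = p" "f y = q" by blast
    show "\<exists>p\<in>verts G. \<exists>q\<in>verts G. l (f p) = l (f v) \<and> l (f q) = l (f v) \<and>
      (\<forall>p' q'. p \<rightarrow>\<^bsub>G\<^esub> p' \<longrightarrow> q \<rightarrow>\<^bsub>G\<^esub> q' \<longrightarrow> l (f p') \<noteq> l (f v) \<longrightarrow> l (f q') \<noteq> l (f v) \<longrightarrow> p' \<rightarrow>\<^bsub>G\<^esub> q')"
    proof (rule bexI[OF _ xy(1)], rule bexI[OF _ xy(2)], intro conjI allI impI)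
      fix p' q' assume A: "x \<rightarrow>\<^bsub>G\<^esub> p'" "y \<rightarrow>\<^bsub>G\<^esub> q'" "l (f p') \<noteq> l (f v)" "l (f q') \<noteq> l (f v)"
      then have V: "p' \<in> verts G" "q' \<in> verts G" using adj_in_verts by auto
      then show "p' \<rightarrow>\<^bsub>G\<^esub> q'" using A xy by (simp add: adj H)
    qed (use pq xy in simp_all)
  qed
qed

text \<open>The classes are the \<open>2 n\<close> triangles. The witnesses in each are its y and z
  vertices, whose outer neighbours are the y and z vertices of the opposite triangle and hence
  adjacent.\<close>

lemma localizable_F_graph:
  assumes "digraph_iso G (with_proj (F_graph n))"
  shows "localizable G"
proof -
  define l where "l u = (case u of Fx i \<Rightarrow> (i, True) | Fy i \<Rightarrow> (i, True) | Fz i \<Rightarrow> (i, True)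
    | Fx' i \<Rightarrow> (i, False) | Fy' i \<Rightarrow> (i, False) | Fz' i \<Rightarrow> (i, False))" for u
  show ?thesis
  proof (rule localizable_isoI[OF assms, of l])
    fix u v assume "u \<in> pverts (F_graph n)" "v \<in> pverts (F_graph n)" "l u = l v" "u \<noteq> v"
    then show "(u, v) \<in> parcs (F_graph n)"
      by (cases u; cases v) (auto simp: l_def verts_F_graph F_graph_neighbours)
  next
    fix v assume v: "v \<in> pverts (F_graph n)"
    then obtain i where i: "i \<in> {1..n}" "v \<in> {Fx i, Fx' i, Fy i, Fy' i, Fz i, Fz' i}"
      unfolding verts_F_graph by blast
    then have V: "Fy i \<in> pverts (F_graph n)" "Fz i \<in> pverts (F_graph n)"
      "Fy' i \<in> pverts (F_graph n)" "Fz' i \<in> pverts (F_graph n)"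
      by (auto simp: verts_F_graph)
    show "\<exists>p\<in>pverts (F_graph n). \<exists>q\<in>pverts (F_graph n). l p = l v \<and> l q = l v \<and>
      (\<forall>p' q'. (p, p') \<in> parcs (F_graph n) \<longrightarrow> (q, q') \<in> parcs (F_graph n) \<longrightarrow>
        l p' \<noteq> l v \<longrightarrow> l q' \<noteq> l v \<longrightarrow> (p', q') \<in> parcs (F_graph n))"
    proof (cases "snd (l v)")
      case True
      show ?thesis
        by (rule bexI[OF _ V(1)], rule bexI[OF _ V(2)])
          (use i True in \<open>auto simp: l_def F_graph_neighbours\<close>)
    next
      case False
      show ?thesis
        by (rule bexI[OF _ V(3)], rule bexI[OF _ V(4)])
          (use i False in \<open>auto simp: l_def F_graph_neighbours\<close>)
    qed
  qed
qed

text \<open>The whole vertex set is one class, so the condition on outer neighbours is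
  vacuous.\<close>

lemma localizable_K4:
  assumes "K\<^bsub>4\<^esub> G"
  shows "localizable G"
proof (rule localizableI[of "\<lambda>_. ()"])
  fix u v assume "u \<in> verts G" "v \<in> verts G" "u \<noteq> v"
  then show "u \<rightarrow>\<^bsub>G\<^esub> v" using assms by (simp add: complete_digraph_def)
qed auto

text \<open>The classes are the edges of a perfect matching, given by a bijection \<open>h\<close>
  between the sides. Each edge is labelled by its end in \<open>W\<close>, so \<open>l v\<close>
  serves as one of the two witnesses.\<close>

lemma localizable_K33:
  assumes "K\<^bsub>3,3\<^esub> G"
  shows "localizable G"
proof -
  obtain U W where UW: "verts G = U \<union> W" "U \<inter> W = {}" "card U = 3" "card W = 3"
    and adj: "arcs_ends G = U \<times> W \<union> W \<times> U"
    using assms unfolding complete_bipartite_digraph_def by blast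
  have "finite U" "finite W" using UW finite_verts by (metis finite_Un)+
  then obtain h where h: "bij_betw h U W" using UW finite_same_card_bij by metis
  define l where "l v = (if v \<in> U then h v else v)" for v
  have hW: "h u \<in> W" if "u \<in> U" for u using h that by (auto simp: bij_betw_def)
  have lU: "l u = h u" if "u \<in> U" for u using that by (simp add: l_def)
  have lW: "l w = w" if "w \<in> W" for w using that UW(2) by (auto simp: l_def)
  have inj: "u = v" if "u \<in> U" "v \<in> U" "h u = h v" for u v
    using h that by (auto simp: bij_betw_def inj_on_def)
  show ?thesis
  proof (rule localizableI[of l])
    fix u v assume "u \<in> verts G" "v \<in> verts G" "l u = l v" "u \<noteq> v"
    then show "u \<rightarrow>\<^bsub>G\<^esub> v" unfolding adj UW(1) using inj lU lW by (metis SigmaI UnE UnI1 UnI2)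
  next
    fix v assume "v \<in> verts G"
    then have "l v \<in> W" unfolding UW(1) using hW lU lW by (metis UnE)
    then obtain p where p: "p \<in> U" "l p = l v" using h lU unfolding bij_betw_def by (metis imageE)
    have "l (l v) = l v" using lW \<open>l v \<in> W\<close> by simp
    moreover have "p' \<rightarrow>\<^bsub>G\<^esub> q'" if "p \<rightarrow>\<^bsub>G\<^esub> p'" "l v \<rightarrow>\<^bsub>G\<^esub> q'" for p' q'
      using that p(1) \<open>l v \<in> W\<close> UW(2) unfolding adj by blast
    moreover have "p \<in> verts G" "l v \<in> verts G" using p(1) \<open>l v \<in> W\<close> UW(1) by auto
    ultimately show "\<exists>p\<in>verts G. \<exists>q\<in>verts G. l p = l v \<and> l q = l v \<and>
      (\<forall>p' q'. p \<rightarrow>\<^bsub>G\<^esub> p' \<longrightarrow> q \<rightarrow>\<^bsub>G\<^esub> q' \<longrightarrow> l p' \<noteq> l v \<longrightarrow> l q' \<noteq> l v \<longrightarrow> p' \<rightarrow>\<^bsub>G\<^esub> q')"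
      using p(2) by metis
  qed
qed

end

section \<open>The case \<open>n = 1\<close> and the complement of the 6-cycle\<close>

lemma F_graph_wf: "parcs (F_graph n) \<subseteq> pverts (F_graph n) \<times> pverts (F_graph n)"
proof -
  have "i mod n + 1 \<in> {1..n}" if "i \<in> {1..n}" for i
    using that by (simp add: Suc_le_eq)
  then show ?thesis by (auto simp: F_graph_def symcl_def)
qed

lemma complement_C6_neighbours:
  "(0, t) \<in> parcs (graph_complement (with_proj (cycle_graph 6))) \<longleftrightarrow> t \<in> {2, 3, 4}"
  "(1, t) \<in> parcs (graph_complement (with_proj (cycle_graph 6))) \<longleftrightarrow> t \<in> {3, 4, 5}"
  "(2, t) \<in> parcs (graph_complement (with_proj (cycle_graph 6))) \<longleftrightarrow> t \<in> {0, 4, 5}"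
  "(3, t) \<in> parcs (graph_complement (with_proj (cycle_graph 6))) \<longleftrightarrow> t \<in> {0, 1, 5}"
  "(4, t) \<in> parcs (graph_complement (with_proj (cycle_graph 6))) \<longleftrightarrow> t \<in> {0, 1, 2}"
  "(5, t) \<in> parcs (graph_complement (with_proj (cycle_graph 6))) \<longleftrightarrow> t \<in> {1, 2, 3}"
proof -
  have E: "(u, v) \<in> parcs (graph_complement (with_proj (cycle_graph 6))) \<longleftrightarrow>
    u < 6 \<and> v < 6 \<and> u \<noteq> v \<and> v \<noteq> (u + 1) mod 6 \<and> u \<noteq> (v + 1) mod 6" for u v
    by (auto simp: graph_complement_def cycle_graph_def symcl_def)
  consider "t \<ge> 6" | "t = 0" | "t = 1" | "t = 2" | "t = 3" | "t = 4" | "t = 5" by linarith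
  note cases = this
  show "(0, t) \<in> parcs (graph_complement (with_proj (cycle_graph 6))) \<longleftrightarrow> t \<in> {2, 3, 4}"
    by (cases rule: cases) (simp_all add: E)
  show "(1, t) \<in> parcs (graph_complement (with_proj (cycle_graph 6))) \<longleftrightarrow> t \<in> {3, 4, 5}"
    by (cases rule: cases) (simp_all add: E)
  show "(2, t) \<in> parcs (graph_complement (with_proj (cycle_graph 6))) \<longleftrightarrow> t \<in> {0, 4, 5}"
    by (cases rule: cases) (simp_all add: E)
  show "(3, t) \<in> parcs (graph_complement (with_proj (cycle_graph 6))) \<longleftrightarrow> t \<in> {0, 1, 5}"
    by (cases rule: cases) (simp_all add: E)
  show "(4, t) \<in> parcs (graph_complement (with_proj (cycle_graph 6))) \<longleftrightarrow> t \<in> {0, 1, 2}"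
    by (cases rule: cases) (simp_all add: E)
  show "(5, t) \<in> parcs (graph_complement (with_proj (cycle_graph 6))) \<longleftrightarrow> t \<in> {1, 2, 3}"
    by (cases rule: cases) (simp_all add: E)
qed

lemma F_graph_1_iso_complement_C6:
  "digraph_iso (with_proj (F_graph 1)) (with_proj (graph_complement (with_proj (cycle_graph 6))))"
    (is "digraph_iso ?F (with_proj ?H)")
proof -
  interpret nomulti_digraph ?F
    using F_graph_wf[of 1] by unfold_locales (auto simp: arc_to_ends_def)
  \<comment> \<open>In the complement of the 6-cycle the triangles are 0, 2, 4 and 1, 3, 5, and
    \<open>k\<close> is matched with \<open>k + 3\<close>. For \<open>n = 1\<close> the index
    \<open>1 mod 1 + 1\<close> is 1, so \<open>F_graph 1\<close> is the same prism.\<close>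
  let ?g = "(!) [Fx 1, Fz' 1, Fy 1, Fx' 1, Fz 1, Fy' 1]"
  have V: "pverts ?H = {0, 1, 2, 3, 4, 5}"
    by (auto simp: graph_complement_def cycle_graph_def)
  show ?thesis
  proof (rule digraph_iso_with_projI[of ?g])
    show "inj_on ?g (pverts ?H)" unfolding V by simp
    show "?g ` pverts ?H = verts ?F" unfolding V by (auto simp: F_graph_def)
    show "parcs ?H \<subseteq> pverts ?H \<times> pverts ?H" by (auto simp: graph_complement_def)
  next
    fix u v assume "u \<in> pverts ?H"
    then show "?g u \<rightarrow>\<^bsub>?F\<^esub> v \<longleftrightarrow> (\<exists>t. (u, t) \<in> parcs ?H \<and> v = ?g t)"
      unfolding V by (elim insertE emptyE)
        (auto simp: complement_C6_neighbours complement_C6_neighbours(2)[unfolded One_nat_def]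
          F_graph_neighbours conj_disj_distribR ex_disj_distrib)
  qed
qed

section \<open>The classification\<close>

context strong_triangle_graph
begin

lemma adj_iff: "v \<in> verts G \<Longrightarrow> v \<rightarrow>\<^bsub>G\<^esub> w \<longleftrightarrow> tri v w \<or> w = mate v"
  by (erule local_structure) blast

lemma not_tri_mate: "v \<in> verts G \<Longrightarrow> \<not> tri v (mate v)"
  by (erule local_structure) metis

lemma mate_in: "v \<in> verts G \<Longrightarrow> mate v \<in> verts G"
  using adj_iff adj_in_verts by blast

lemma mate_mate: "v \<in> verts G \<Longrightarrow> mate (mate v) = v"
  using adj_iff not_tri_mate mate_in adj_sym tri_sym by metis

lemma tri_in: "tri u v \<Longrightarrow> u \<in> verts G"
  using adj_in_verts by (auto simp: tri_def)

text \<open>Only \<open>mates_tri\<close> uses strength: three pairwise nonadjacent mates would be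
  an independent set dominating the triangle.\<close>

lemma matched_triangles: "matched_triangles (verts G) tri mate"
proof
  show "finite (verts G)" by simp
  fix v
  show "\<not> tri v v" using adj_irrefl by (simp add: tri_def)
  assume v: "v \<in> verts G"
  show "mate v \<in> verts G" "mate (mate v) = v" "\<not> tri v (mate v)"
    using v mate_in mate_mate not_tri_mate by auto
  show "mate v \<noteq> v" using v adj_iff adj_irrefl by metis
  show "\<exists>a b. a \<noteq> b \<and> (\<forall>w. tri v w \<longleftrightarrow> w = a \<or> w = b)"
    using local_structure[OF v] by metis
next
  show "tri u v \<Longrightarrow> u \<in> verts G" "tri u v \<Longrightarrow> tri v u" for u v
    using tri_in tri_sym by blast+
next
  fix u v w assume t: "tri u v" "tri u w" "v \<noteq> w"
  obtain a b where "a \<rightarrow>\<^bsub>G\<^esub> b" "\<And>w. tri u w \<longleftrightarrow> w = a \<or> w = b"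
    using local_structure[OF tri_in[OF t(1)]] by metis
  then have "v \<rightarrow>\<^bsub>G\<^esub> w" using t adj_sym by metis
  moreover have "v \<rightarrow>\<^bsub>G\<^esub> u" "w \<rightarrow>\<^bsub>G\<^esub> u" using t adj_sym by (auto simp: tri_def)
  ultimately show "tri v w" by (auto simp: tri_def)
next
  fix v a b assume t: "tri v a" "tri v b" "a \<noteq> b"
  have V: "v \<in> verts G" "a \<in> verts G" "b \<in> verts G" using t tri_in tri_sym by blast+
  obtain a' b' where s: "strong_clique G {v, a', b'}" "a' \<rightarrow>\<^bsub>G\<^esub> b'"
    "\<And>w. tri v w \<longleftrightarrow> w = a' \<or> w = b'"
    using local_structure[OF V(1)] by metis
  then have ab: "{a', b'} = {a, b}" using t by auto
  then have strong: "strong_clique G {v, a, b}" using s(1) by simp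
  have "tri a b"
    using t s ab adj_sym unfolding tri_def by (metis doubleton_eq_iff)
  show "tri (mate v) (mate a) \<or> tri (mate v) (mate b) \<or> tri (mate a) (mate b)"
  proof (rule ccontr)
    assume no: "\<not> ?thesis"
    \<comment> \<open>Adjacent mates that are not \<open>tri\<close> would be mates of each other,
      giving \<open>y = mate x\<close>, although \<open>x\<close> and \<open>y\<close> share a
      triangle.\<close>
    have non: "\<not> mate x \<rightarrow>\<^bsub>G\<^esub> mate y" "\<not> mate y \<rightarrow>\<^bsub>G\<^esub> mate x"
      if "tri x y" "\<not> tri (mate x) (mate y)" for x y
    proof -
      have "x \<in> verts G" "y \<in> verts G" using that tri_in tri_sym by blast+
      then show "\<not> mate x \<rightarrow>\<^bsub>G\<^esub> mate y"
        using that adj_iff[of "mate x" "mate y"] mate_in mate_mate not_tri_mate tri_sym by metis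
      then show "\<not> mate y \<rightarrow>\<^bsub>G\<^esub> mate x" using adj_sym by blast
    qed
    have "independent_set G {mate v, mate a, mate b}"
      using V mate_in adj_irrefl non[OF t(1)] non[OF t(2)] non[OF \<open>tri a b\<close>] no
      by (auto simp: independent_set_def)
    then show False
      by (rule strong_clique_not_dominated[OF strong]) (use adj_iff V in blast)
  qed
qed

text \<open>The embedded copy already contains all neighbours of its vertices, so connectedness
  makes it the whole graph.\<close>

lemma iso_F_graph: "\<exists>n\<ge>1. digraph_iso G (with_proj (F_graph n))"
proof -
  interpret M: matched_triangles "verts G" tri mate by (rule matched_triangles)
  obtain v where "v \<in> verts G" using conn unfolding connected_conv by blast
  then obtain w0 where w0: "w0 \<in> M.ends" using M.ex_end by blast
  let ?n = "M.period w0"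
  obtain g where g: "inj_on g (pverts (F_graph ?n))" "g ` pverts (F_graph ?n) \<subseteq> verts G"
    and tri: "\<And>u v. u \<in> pverts (F_graph ?n) \<Longrightarrow>
      tri (g u) v \<or> v = mate (g u) \<longleftrightarrow> (\<exists>t. (u, t) \<in> parcs (F_graph ?n) \<and> v = g t)"
    using M.F_graph_embedding[OF w0] by blast
  have adj: "g u \<rightarrow>\<^bsub>G\<^esub> v \<longleftrightarrow> (\<exists>t. (u, t) \<in> parcs (F_graph ?n) \<and> v = g t)"
    if "u \<in> pverts (F_graph ?n)" for u v
    using tri[OF that] adj_iff g(2) that by blast
  have n: "?n \<ge> 1" using M.period(1)[OF w0] by simp
  then have "Fx 1 \<in> pverts (F_graph ?n)" by (auto simp: verts_F_graph)
  then have "g ` pverts (F_graph ?n) = verts G"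
  proof (intro connected_closed_eq_verts[OF conn _ g(2)])
    fix u v assume "u \<in> g ` pverts (F_graph ?n)" "u \<rightarrow>\<^bsub>G\<^esub> v"
    then show "v \<in> g ` pverts (F_graph ?n)" using adj F_graph_wf by blast
  qed auto
  then have "digraph_iso G (with_proj (F_graph ?n))"
    using digraph_iso_with_projI g(1) F_graph_wf adj by metis
  with n show ?thesis by blast
qed

end

lemma (in connected_cubic_graph) strong_clique_at_all_imp:
  assumes "\<forall>v \<in> verts G. \<exists>C. strong_clique G C \<and> v \<in> C"
  shows "K\<^bsub>3,3\<^esub> G \<or> K\<^bsub>4\<^esub> G \<or> (\<exists>n\<ge>1. digraph_iso G (with_proj (F_graph n)))"
proof (rule ccontr)
  assume no: "\<not> ?thesis"
  interpret strong_triangle_graph G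
  proof
    show "clique G C \<Longrightarrow> card C \<noteq> 4" for C using no K4_if_clique_4 by blast
  next
    fix v assume "v \<in> verts G"
    then obtain C where C: "strong_clique G C" "v \<in> C" using assms by blast
    then show "\<exists>a b. strong_clique G {v, a, b} \<and> a \<noteq> b \<and> v \<rightarrow>\<^bsub>G\<^esub> a \<and> v \<rightarrow>\<^bsub>G\<^esub> b \<and> a \<rightarrow>\<^bsub>G\<^esub> b"
    proof (cases rule: strong_clique_cases)
      case (3 a b)
      then show ?thesis using C(1) by blast
    qed (use no in simp_all)
  qed
  show False using iso_F_graph no by blast
qed

theorem theorem6p8:
  fixes G :: "('a, 'b) pre_digraph"
  assumes "graph G" and "Digraph_Component.connected G" and "cubic G"
  shows "(localizable G \<longleftrightarrow> (\<forall>v \<in> verts G. \<exists>C. strong_clique G C \<and> v \<in> C)) \<and>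
         ((\<forall>v \<in> verts G. \<exists>C. strong_clique G C \<and> v \<in> C) \<longleftrightarrow>
            K\<^bsub>3,3\<^esub> G \<or> K\<^bsub>4\<^esub> G \<or>
            digraph_iso G (with_proj (graph_complement (with_proj (cycle_graph 6)))) \<or>
            (\<exists>n\<ge>2. digraph_iso G (with_proj (F_graph n))))"
    (is "(?loc \<longleftrightarrow> ?cov) \<and> (?cov \<longleftrightarrow> ?K33 \<or> ?K4 \<or> ?C6 \<or> ?F)")
proof -
  interpret graph G by fact
  interpret connected_cubic_graph G using assms by unfold_locales
  have wf: "wf_digraph (with_proj (F_graph 1))"
    using F_graph_wf[of 1] by unfold_locales auto
  \<comment> \<open>Reading the complement of the 6-cycle as \<open>F_graph 1\<close> merges it with
    the family into the single range \<open>n \<ge> 1\<close>.\<close>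
  have C6: "?C6 \<longleftrightarrow> digraph_iso G (with_proj (F_graph 1))"
    using digraph_iso_trans[OF _ F_graph_1_iso_complement_C6]
      digraph_iso_trans[OF _ digraph_iso_swap[OF wf F_graph_1_iso_complement_C6]] by blast
  have ge_1_iff: "1 \<le> n \<longleftrightarrow> n = 1 \<or> 2 \<le> n" for n :: nat by auto
  have "(\<exists>n\<ge>1. digraph_iso G (with_proj (F_graph n))) \<longleftrightarrow> ?C6 \<or> ?F"
    unfolding C6 ge_1_iff by blast
  then have F: "?cov \<Longrightarrow> ?K33 \<or> ?K4 \<or> ?C6 \<or> ?F"
    using strong_clique_at_all_imp by blast
  have loc: "?loc" if "?K33 \<or> ?K4 \<or> ?C6 \<or> ?F"
    using that
  proof (elim disjE exE conjE)
    show "?C6 \<Longrightarrow> ?loc" unfolding C6 by (rule localizable_F_graph)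
  next
    show "digraph_iso G (with_proj (F_graph n)) \<Longrightarrow> ?loc" for n
      by (rule localizable_F_graph)
  qed (fact localizable_K33 localizable_K4)+
  have cov: "?loc \<Longrightarrow> ?cov" by (intro ballI localizable_imp_strong_clique_at)
  show ?thesis using F loc cov by blast
qed

end
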